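(* Let $S$ be a finite generating set of the group $\mathbb{Z}$. Then there are only finitely many dead ends in $\mathbb{Z}$ with respect to $S$.
   Context: For a finite generating set $S$ of $\mathbb{Z}$, the length $\ell(n)$ of $n\in\mathbb{Z}$ is the least $k$ such that $n=s_1+\dots+s_k$ with each $s_i\in S\cup(-S)$. A dead end with respect to $S$ is an integer $d$ such that $\ell(d+s)\le\ell(d)$ for every $s\in S\cup(-S)$. *)

theory Defs
  imports Complex_Main "HOL-Computational_Algebra.Group_Closure"
begin

(* The set of k is nonempty for every n whenever group_closure S = UNIV;
   the value is unspecified when n is outside the subgroup generated by S. *)
definition word_length :: "int set \<Rightarrow> int \<Rightarrow> nat" where
  "word_length S n =
     (LEAST k. \<exists>xs. length xs = k \<and> set xs \<subseteq> S \<union> uminus ` S \<and> sum_list xs = n)"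

definition dead_end :: "int set \<Rightarrow> int \<Rightarrow> bool" where
  "dead_end S d \<longleftrightarrow>
     (\<forall>s \<in> S \<union> uminus ` S. word_length S (d + s) \<le> word_length S d)"

end

theory Submission
  imports Defs
begin

text \<open>
  Let \<open>a\<close> be the largest element of \<open>S \<union> -S\<close>. If a word has at least \<open>a\<close> letters other than
  \<open>\<plusminus>a\<close>, two of its partial sums agree modulo \<open>a\<close>, and the segment between them can be replaced
  by fewer letters \<open>\<plusminus>a\<close>. Hence a shortest word for \<open>n > a\<^sup>2\<close> must contain \<open>a\<close>, so the length of
  \<open>n - a\<close> is smaller than that of \<open>n\<close>, and no integer above \<open>a\<^sup>2\<close> is a dead end.
  Negation handles the integers below \<open>-a\<^sup>2\<close>.
\<close>

lemma group_closure_word: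
  fixes S :: "int set"
  assumes "n \<in> group_closure S"
  shows "\<exists>xs. set xs \<subseteq> S \<union> uminus ` S \<and> sum_list xs = n"
  using assms
proof (induction rule: group_closure.induct)
  case (base s)
  show ?case
  \<comment> \<open>The base rule of \<open>group_closure\<close> also admits 0, which need not lie
    in \<open>S\<close>; the empty word represents it.\<close>
  proof (cases "s = 0")
    case True
    then show ?thesis by (intro exI[of _ "[]"]) auto
  next
    case False
    with base show ?thesis by (intro exI[of _ "[s]"]) auto
  qed
next
  case (diff s t)
  then obtain xs ys where *: "set xs \<subseteq> S \<union> uminus ` S" "sum_list xs = s"
    "set ys \<subseteq> S \<union> uminus ` S" "sum_list ys = t" by blast
  have "sum_list (map uminus ys) = - t"
    using uminus_sum_list_map[of id ys] * by (simp add: o_def)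
  with * show ?case by (intro exI[of _ "xs @ map uminus ys"]) auto
qed

lemma word_length_le:
  assumes "set xs \<subseteq> S \<union> uminus ` S"
  shows "word_length S (sum_list xs) \<le> length xs"
  unfolding word_length_def using assms by (intro Least_le) auto

lemma word_length_attained:
  assumes "n \<in> group_closure S"
  obtains xs where "length xs = word_length S n" "set xs \<subseteq> S \<union> uminus ` S" "sum_list xs = n"
proof -
  let ?P = "\<lambda>k. \<exists>xs. length xs = k \<and> set xs \<subseteq> S \<union> uminus ` S \<and> sum_list xs = n"
  have "\<exists>k. ?P k" using group_closure_word[OF assms] by blast
  then have "?P (word_length S n)" unfolding word_length_def by (rule LeastI_ex)
  then show thesis using that by blast
qed

lemma word_length_uminus: "word_length S (- n) = word_length S n"
proof -
  \<comment> \<open>One implication for arbitrary \<open>m\<close>; its instances at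
    \<open>n\<close> and \<open>- n\<close> give both directions of the equivalence.\<close>
  have "\<exists>ys. length ys = k \<and> set ys \<subseteq> S \<union> uminus ` S \<and> sum_list ys = - m"
    if "\<exists>xs. length xs = k \<and> set xs \<subseteq> S \<union> uminus ` S \<and> sum_list xs = m" for k and m :: int
  proof -
    from that obtain xs where "length xs = k" "set xs \<subseteq> S \<union> uminus ` S" "sum_list xs = m"
      by blast
    then show ?thesis
      using uminus_sum_list_map[of id xs]
      by (intro exI[of _ "map uminus xs"]) (auto simp: o_def)
  qed
  from this[of _ n] this[of _ "- n"] show ?thesis
    unfolding word_length_def minus_minus
    by (intro arg_cong[where f = Least] ext iffI)
qed

lemma dead_end_uminus:
  assumes "dead_end S d"
  shows "dead_end S (- d)"
  unfolding dead_end_def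
proof
  fix s assume "s \<in> S \<union> uminus ` S"
  then have "- s \<in> S \<union> uminus ` S" by auto
  then have "word_length S (d + - s) \<le> word_length S d"
    using assms unfolding dead_end_def by blast
  then show "word_length S (- d + s) \<le> word_length S (- d)"
    using word_length_uminus[of S "d + - s"] word_length_uminus[of S d] by simp
qed

lemma abs_sum_list_le_const:
  fixes xs :: "int list"
  assumes "\<forall>x\<in>set xs. \<bar>x\<bar> \<le> b"
  shows "\<bar>sum_list xs\<bar> \<le> int (length xs) * b"
  using assms
proof (induction xs)
  case (Cons x xs)
  then have "\<bar>x\<bar> \<le> b" "\<bar>sum_list xs\<bar> \<le> int (length xs) * b" by auto
  then show ?case by (simp add: algebra_simps)
qed simp

text \<open>Pigeonhole on prefix sums modulo \<open>a\<close>: counting the empty prefix there are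
  \<open>length ys + 1\<close> of them, more than the \<open>a\<close> residues. Two congruent
  prefix sums differ by the sum of the segment between them.\<close>

lemma exists_segment_sum_dvd:
  fixes ys :: "int list"
  assumes "0 < a" "a \<le> int (length ys)"
  obtains us vs ws where "ys = us @ vs @ ws" "vs \<noteq> []" "a dvd sum_list vs"
proof -
  let ?f = "\<lambda>i. sum_list (take i ys) mod a"
  have "?f ` {..length ys} \<subseteq> {0..<a}" using assms(1) by auto
  then have "card (?f ` {..length ys}) \<le> card {0..<a}" by (intro card_mono) auto
  also have "\<dots> < card {..length ys}" using assms by simp
  finally have "\<not> inj_on ?f {..length ys}" by (rule pigeonhole)
  then obtain i j where "i \<le> length ys" "j \<le> length ys" "i \<noteq> j" "?f i = ?f j"
    unfolding inj_on_def by auto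
  then obtain i j where ij: "i < j" "j \<le> length ys" "?f i = ?f j"
    by (metis nat_neq_iff)
  let ?vs = "drop i (take j ys)"
  have pre: "take j ys = take i ys @ ?vs"
    using ij by (metis append_take_drop_id min.absorb1 less_imp_le take_take)
  then have "sum_list ?vs = sum_list (take j ys) - sum_list (take i ys)"
    by (metis add_diff_cancel_left' sum_list_append)
  then have "a dvd sum_list ?vs" using ij(3) by (metis mod_eq_dvd_iff)
  moreover have "ys = take i ys @ ?vs @ drop j ys"
    using pre by (metis append.assoc append_take_drop_id)
  moreover have "?vs \<noteq> []" using ij by simp
  ultimately show thesis using that by blast
qed

text \<open>A nonempty segment with sum \<open>a * m\<close> has letters of absolute value at most
  \<open>a - 1\<close>, which forces \<open>\<bar>m\<bar>\<close> below its length. So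
  \<open>\<bar>m\<bar>\<close> copies of \<open>a\<close> or of \<open>- a\<close> replace it by
  fewer letters.\<close>

lemma exists_shorter_word:
  fixes a :: int and ys :: "int list"
  assumes "0 < a" "a \<le> int (length ys)" "\<forall>y\<in>set ys. \<bar>y\<bar> < a"
  obtains zs where "set zs \<subseteq> set ys \<union> {a, - a}" "sum_list zs = sum_list ys"
    "length zs < length ys"
proof -
  obtain us vs ws where ys: "ys = us @ vs @ ws" "vs \<noteq> []" "a dvd sum_list vs"
    using exists_segment_sum_dvd[OF assms(1,2)] .
  obtain m where m: "sum_list vs = a * m" using ys(3) by blast
  have "a * \<bar>m\<bar> = \<bar>sum_list vs\<bar>" using m assms(1) by (simp add: abs_mult)
  also have "\<dots> \<le> int (length vs) * (a - 1)"
    using assms(3) ys by (intro abs_sum_list_le_const) force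
  also have "\<dots> < a * int (length vs)" using ys(2) by (simp add: algebra_simps)
  finally have "\<bar>m\<bar> < int (length vs)" using assms(1) by simp
  \<comment> \<open>For \<open>m = 0\<close> the replacement is empty, so the letter
    \<open>sgn 0 * a = 0\<close> never occurs.\<close>
  moreover have "sum_list (replicate (nat \<bar>m\<bar>) (sgn m * a)) = a * m"
    by (simp add: sum_list_replicate sgn_if)
  moreover have "set (replicate (nat \<bar>m\<bar>) (sgn m * a)) \<subseteq> {a, - a}"
    by (auto simp: sgn_if split: if_splits)
  ultimately show thesis
    using ys m by (intro that[of "us @ replicate (nat \<bar>m\<bar>) (sgn m * a) @ ws"]) auto
qed

lemma max_generator_in_shortest_word:
  fixes S :: "int set"
  defines "T \<equiv> S \<union> uminus ` S"
  assumes a: "a \<in> T" "0 < a" and max: "\<forall>s\<in>T. s \<le> a"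
    and xs: "set xs \<subseteq> T" "length xs = word_length S (sum_list xs)" "a * a < sum_list xs"
  shows "a \<in> set xs"
proof (rule ccontr)
  assume na: "a \<notin> set xs"
  have neg: "- s \<in> T" if "s \<in> T" for s using that unfolding T_def by auto
  \<comment> \<open>Letters \<open>- a\<close> are set aside because shortening needs all absolute
    values strictly below \<open>a\<close>.\<close>
  let ?ys = "filter (\<lambda>x. x \<noteq> - a) xs" and ?ns = "filter (\<lambda>x. \<not> x \<noteq> - a) xs"
  have split: "sum_list ?ys + sum_list ?ns = sum_list xs" by (induction xs) auto
  have len: "length ?ys + length ?ns = length xs" by (rule sum_length_filter_compl)
  have small: "\<forall>y\<in>set ?ys. \<bar>y\<bar> < a"
  proof
    fix y assume y: "y \<in> set ?ys"
    then have "y \<in> T" "y \<noteq> a" "y \<noteq> - a" using xs(1) na by auto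
    then have "y \<le> a" "- y \<le> a" using max neg by blast+
    with \<open>y \<noteq> a\<close> \<open>y \<noteq> - a\<close> show "\<bar>y\<bar> < a" by linarith
  qed
  have "int (length ?ys) < a"
  proof (rule ccontr)
    assume "\<not> int (length ?ys) < a"
    then obtain zs where zs: "set zs \<subseteq> set ?ys \<union> {a, - a}" "sum_list zs = sum_list ?ys"
      "length zs < length ?ys" using exists_shorter_word[OF a(2) _ small] by force
    have "set (zs @ ?ns) \<subseteq> T" using zs(1) xs(1) a(1) neg by auto
    then have "word_length S (sum_list (zs @ ?ns)) \<le> length (zs @ ?ns)"
      unfolding T_def by (rule word_length_le)
    then show False using zs split len xs(2) by simp
  qed
  \<comment> \<open>The letters set aside only lower the sum, so fewer than \<open>a\<close> letters
    of size below \<open>a\<close> would have to exceed \<open>a * a\<close>.\<close>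
  have "sum_list ?ns \<le> 0" using a(2) by (intro sum_list_nonpos) auto
  with split have "sum_list xs \<le> \<bar>sum_list ?ys\<bar>" by linarith
  also have "\<dots> \<le> int (length ?ys) * a" using small by (intro abs_sum_list_le_const) auto
  also have "\<dots> \<le> a * a" using \<open>int (length ?ys) < a\<close> a(2) by (intro mult_right_mono) auto
  finally show False using xs(3) by simp
qed

theorem theorem3:
  fixes S :: "int set"
  assumes "finite S"
    and "group_closure S = UNIV"
  shows "finite {d. dead_end S d}"
proof -
  let ?T = "S \<union> uminus ` S"
  define a where "a = Max ?T"
  \<comment> \<open>A word with sum 1 must contain a positive letter, so the maximum
    \<open>a\<close> is positive.\<close>
  obtain xs where "set xs \<subseteq> ?T" "sum_list xs = 1"
    using group_closure_word[of 1 S] assms(2) by auto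
  then obtain s where s: "s \<in> ?T" "0 < s"
    by (metis not_less sum_list_nonpos subsetD zero_less_one)
  have fin: "finite ?T" using assms(1) by simp
  have aT: "a \<in> ?T" unfolding a_def using fin s by (intro Max_in) auto
  have amax: "\<forall>t\<in>?T. t \<le> a" unfolding a_def using fin by auto
  have a0: "0 < a" using s(2) bspec[OF amax s(1)] by (rule less_le_trans)
  have upper: "d \<le> a * a" if d: "dead_end S d" for d
  proof (rule ccontr)
    assume big: "\<not> d \<le> a * a"
    \<comment> \<open>The neighbour \<open>d + a\<close> also exceeds \<open>a * a\<close>, so its
      shortest word contains \<open>a\<close>; deleting one \<open>a\<close> leaves a shorter word
      for \<open>d\<close>, although \<open>d\<close> is a dead end.\<close>
    obtain xs where xs: "length xs = word_length S (d + a)" "set xs \<subseteq> ?T" "sum_list xs = d + a"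
      using word_length_attained[of "d + a" S] assms(2) by auto
    have "a \<in> set xs"
      using max_generator_in_shortest_word[OF aT a0 amax xs(2)] xs big a0 by simp
    then have "sum_list (remove1 a xs) = d" "length (remove1 a xs) < length xs"
      using xs(3) sum_list_map_remove1[of a xs id] length_pos_if_in_set[of a xs]
      by (auto simp: length_remove1)
    moreover have "set (remove1 a xs) \<subseteq> ?T" using xs(2) set_remove1_subset by fast
    ultimately have "word_length S d < word_length S (d + a)"
      using word_length_le[of "remove1 a xs" S] xs(1) by simp
    moreover have "word_length S (d + a) \<le> word_length S d"
      using d aT unfolding dead_end_def by blast
    ultimately show False by simp
  qed
  have "{d. dead_end S d} \<subseteq> {- (a * a)..a * a}"
    using upper dead_end_uminus[THEN upper] by force
  then show ?thesis by (rule finite_subset) simp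
qed

end
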